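(* For a subset $\mathbb S$ of the positive integers define, for $|q|<1$, \[F_{\mathbb S}(q):=\sum_{\substack{\lambda\ne\emptyset\\ \mathrm{sm}(\lambda)\in\mathbb S}}\mu^*_{\mathcal P}(\lambda)q^{|\lambda|},\] the sum over nonempty integer partitions whose smallest part $\mathrm{sm}(\lambda)$ lies in $\mathbb S$, and let $\mathbb S_{r,t}:=\{n\in\mathbb Z^+:n\equiv r\pmod t\}$. If $0\le r<t$ are integers, $m$ is a positive integer with $\gcd(m,t)=1$, and $\zeta$ is a primitive $m$th root of unity, then \[\lim_{q\to\zeta}F_{\mathbb S_{r,t}}(q)=\frac1t,\] where the limit is taken as $q$ tends to $\zeta$ from within the unit disk.
   Context: For a partition $\lambda$, $|\lambda|$ is the sum of its parts and $\ell(\lambda)$ the number of parts. The partition M\"obius function is $\mu_{\mathcal P}(\emptyset)=1$, $\mu_{\mathcal P}(\lambda)=0$ if $\lambda$ has a repeated part, and $\mu_{\mathcal P}(\lambda)=(-1)^{\ell(\lambda)}$ otherwise; $\mu^*_{\mathcal P}:=-\mu_{\mathcal P}$.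
   Formalization: The limit "as q tends to ζ from within the unit disk" is proved as a radial limit (q = ρζ, ρ → 1⁻); the unrestricted limit is false, e.g. for r=0, t=1, ζ=1, where F = 1 − ∏(1−q^k) is unbounded along horocycles at 1. *)

theory Defs
  imports "HOL-Analysis.Analysis" "HOL-Library.Multiset" "HOL-Number_Theory.Cong"
begin

text \<open>
  A partition is the finite multiset of its parts, all of them positive. Thus for a
  partition \<open>p\<close> the sum of the parts is \<open>\<Sum>\<^sub># p\<close>, the number of parts is \<open>size p\<close>, and the
  empty partition is \<open>{#}\<close>.
\<close>

definition partitions :: "nat multiset set" where
  "partitions = {p. \<forall>k \<in># p. 0 < k}"

text \<open>Only meaningful for \<open>p \<noteq> {#}\<close>.\<close>

definition smallest_part :: "nat multiset \<Rightarrow> nat" where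
  "smallest_part p = Min (set_mset p)"

definition partition_mu :: "nat multiset \<Rightarrow> int" where
  "partition_mu p =
     (if p = {#} then 1
      else if \<exists>k. 2 \<le> count p k then 0
      else (-1) ^ size p)"

definition partition_mu_star :: "nat multiset \<Rightarrow> int" where
  "partition_mu_star p = - partition_mu p"

text \<open>
  The family summed here is absolutely summable for \<open>norm q < 1\<close>, so the unordered sum
  is the intended one there; outside the unit disk the value has no significance.
\<close>

definition F_series :: "nat set \<Rightarrow> complex \<Rightarrow> complex" where
  "F_series S q =
     (\<Sum>\<^sub>\<infinity>p \<in> {p \<in> partitions. p \<noteq> {#} \<and> smallest_part p \<in> S}.
        of_int (partition_mu_star p) * q ^ (\<Sum>\<^sub># p))"

definition residue_set :: "nat \<Rightarrow> nat \<Rightarrow> nat set" where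
  "residue_set r t = {n. 0 < n \<and> [n = r] (mod t)}"

definition primitive_root_of_unity :: "nat \<Rightarrow> complex \<Rightarrow> bool" where
  "primitive_root_of_unity m z \<longleftrightarrow>
     0 < m \<and> z ^ m = 1 \<and> (\<forall>k. 0 < k \<and> k < m \<longrightarrow> z ^ k \<noteq> 1)"

text \<open>
  Approach to a point \<open>z\<close> of the unit circle from within the unit disk is radial: \<open>q\<close> runs
  through the points \<open>\<rho> z\<close> with \<open>0 < \<rho> < 1\<close> and \<open>\<rho>\<close> tends to 1. Neither the
  unrestricted filter \<open>at z within ball 0 1\<close> nor the one given by a Stolz angle of
  arbitrary opening would do for \<open>F_series\<close>. For \<open>r = 0\<close> and \<open>t = 1\<close> the series is
  1 minus Euler's product \<open>\<Prod>k\<ge>1. 1 - q ^ k\<close>, which is unbounded along horocycles at 1.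
  For \<open>t = 5\<close> and \<open>r = 1\<close> it is unbounded along \<open>q = exp (- s * (1 + 5 * \<i>))\<close> as the real
  number \<open>s > 0\<close> tends to 0.
\<close>

definition radially_to :: "complex \<Rightarrow> complex filter" where
  "radially_to z = at z within open_segment 0 z"

end

theory Submission
  imports Defs "HOL-Library.Real_Mod" "HOL-Real_Asymp.Real_Asymp"
begin

text \<open>
  Write \<open>(x)\<^sub>n\<close> for the product of \<open>1 - x q ^ k\<close> over \<open>k < n\<close>. Sorting the partitions into
  distinct parts by their smallest part \<open>n\<close> gives \<open>F_series S q\<close> as the sum of
  \<open>q ^ n (q)\<^sub>\<infinity> / (q)\<^sub>n\<close> over \<open>n \<in> S\<close>. For a residue class modulo \<open>t\<close> the condition on \<open>n\<close> is
  detected by the \<open>t\<close>-th roots of unity \<open>w\<close>, and Euler's identity (the sum of \<open>x ^ n / (q)\<^sub>n\<close>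
  is \<open>1 / (x)\<^sub>\<infinity>\<close>) turns the series into a combination of the quotients \<open>(q)\<^sub>\<infinity> / (w q)\<^sub>\<infinity>\<close>.
  The quotient for \<open>w = 1\<close> is 1 and contributes \<open>1 / t\<close>. All others vanish in the radial limit:
  minus the logarithm of their norm is the sum over \<open>l \<ge> 1\<close> of
  \<open>Re ((1 - w ^ l) q ^ l / (1 - q ^ l)) / l\<close>. The terms with \<open>m dvd l\<close> are nonnegative and the one
  with \<open>l = m\<close> grows like \<open>1 / (1 - norm q)\<close>, because \<open>w ^ m \<noteq> 1\<close> by coprimality; the
  other terms together are only \<open>O(ln (1 / (1 - norm q)))\<close>, since \<open>1 - q ^ l\<close> stays away from 0.
\<close>

section \<open>q-Pochhammer products and Euler's identity\<close>

definition qpoch :: "complex \<Rightarrow> complex \<Rightarrow> nat \<Rightarrow> complex" where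
  "qpoch x q n = (\<Prod>k<n. 1 - x * q ^ k)"

lemma qpoch_0 [simp]: "qpoch x q 0 = 1"
  by (simp add: qpoch_def)

lemma qpoch_Suc: "qpoch x q (Suc n) = qpoch x q n * (1 - x * q ^ n)"
  by (simp add: qpoch_def)

lemma norm_mult_power_less_1:
  fixes x q :: complex
  assumes "norm x < 1" "norm q < 1"
  shows "norm (x * q ^ k) < 1"
proof -
  have "norm (x * q ^ k) \<le> norm x"
    using assms by (simp add: norm_mult norm_power mult_left_le power_le_one)
  then show ?thesis using assms by simp
qed

lemma qpoch_nonzero:
  assumes "norm x < 1" "norm q < 1"
  shows "qpoch x q n \<noteq> 0"
proof -
  have "1 - x * q ^ k \<noteq> 0" for k
    using norm_mult_power_less_1[OF assms, of k] by auto
  then show ?thesis by (simp add: qpoch_def)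
qed

text \<open>Comparison with a geometric series gives absolute convergence of the product, and none
  of its factors vanishes.\<close>

lemma qpoch_tendsto_nonzero:
  assumes "norm x < 1" "norm q < 1"
  obtains P where "qpoch x q \<longlonglongrightarrow> P" "P \<noteq> 0"
proof -
  have nz: "1 - x * q ^ k \<noteq> 0" for k
    using norm_mult_power_less_1[OF assms, of k] by auto
  have "summable (\<lambda>k. norm x * norm q ^ k)"
    using assms by (intro summable_mult summable_geometric) auto
  then have "summable (\<lambda>k. norm (- (x * q ^ k)))"
    by (simp add: norm_mult norm_power)
  then have "convergent_prod (\<lambda>k. 1 + - (x * q ^ k))"
    by (intro abs_convergent_prod_imp_convergent_prod summable_imp_abs_convergent_prod) simp
  then have "convergent_prod (\<lambda>k. 1 - x * q ^ k)" by simp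
  then have "qpoch x q \<longlonglongrightarrow> prodinf (\<lambda>k. 1 - x * q ^ k)"
    using has_prod_imp_tendsto'[OF convergent_prod_has_prod] by (simp add: qpoch_def[abs_def])
  moreover have "prodinf (\<lambda>k. 1 - x * q ^ k) \<noteq> 0"
    using \<open>convergent_prod (\<lambda>k. 1 - x * q ^ k)\<close> nz by (rule prodinf_nonzero)
  ultimately show ?thesis by (rule that)
qed

text \<open>Euler's q-exponential. For \<open>x\<close> and \<open>q\<close> in the open unit disk
  its value is \<open>1 / (x)\<^sub>\<infinity>\<close>, as \<open>qexp_mult_power\<close> and
  \<open>qexp_tendsto_1\<close> show together when \<open>n\<close> grows.\<close>

definition qexp :: "complex \<Rightarrow> complex \<Rightarrow> complex" where
  "qexp q x = (\<Sum>n. x ^ n / qpoch q q n)"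

text \<open>The coefficients \<open>1 / (q)\<^sub>n\<close> are bounded, since
  \<open>(q)\<^sub>n\<close> tends to a nonzero limit; a geometric series therefore
  dominates.\<close>

lemma qexp_sums:
  assumes "norm x < 1" "norm q < 1"
  shows "(\<lambda>n. x ^ n / qpoch q q n) sums qexp q x"
proof -
  obtain P where P: "qpoch q q \<longlonglongrightarrow> P" "P \<noteq> 0"
    using qpoch_tendsto_nonzero assms(2) by metis
  have "(\<lambda>n. inverse (qpoch q q n)) \<longlonglongrightarrow> inverse P"
    using P by (rule tendsto_inverse)
  then obtain B where B: "norm (inverse (qpoch q q n)) \<le> B" for n
    using Bseq_def convergentI convergent_imp_Bseq by metis
  have "summable (\<lambda>n. B * norm x ^ n)"
    using assms by (intro summable_mult summable_geometric) auto
  then have "summable (\<lambda>n. x ^ n / qpoch q q n)"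
    by (rule summable_comparison_test'[where N = 0])
      (use B in \<open>simp add: divide_inverse norm_mult norm_power mult.commute[of B] mult_left_mono
        del: norm_inverse\<close>)
  then show ?thesis by (simp add: qexp_def summable_sums)
qed

text \<open>In the difference of the two series the factor \<open>1 - q ^ Suc n\<close> cancels the
  last factor of \<open>qpoch q q (Suc n)\<close>, which leaves the original series shifted by one
  index and multiplied by \<open>x\<close>.\<close>

lemma qexp_mult_q:
  assumes x: "norm x < 1" and q: "norm q < 1"
  shows "qexp q (x * q) = (1 - x) * qexp q x"
proof -
  have xq: "norm (x * q) < 1" using norm_mult_power_less_1[OF x q, of 1] by simp
  let ?f = "\<lambda>n. x ^ n / qpoch q q n - (x * q) ^ n / qpoch q q n"
  have "?f sums (qexp q x - qexp q (x * q))"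
    by (intro sums_diff qexp_sums x q xq)
  moreover have "?f 0 = 0" by simp
  ultimately have "(\<lambda>n. ?f (Suc n)) sums (qexp q x - qexp q (x * q))"
    using sums_Suc_iff[of ?f] by simp
  moreover have "?f (Suc n) = x * (x ^ n / qpoch q q n)" for n
  proof -
    have "1 - q * q ^ n \<noteq> 0" using norm_mult_power_less_1[OF q q, of n] by auto
    then have "(1 - q * q ^ n) / (qpoch q q n * (1 - q * q ^ n)) = 1 / qpoch q q n" by simp
    moreover have "?f (Suc n) = x * x ^ n * ((1 - q * q ^ n) / (qpoch q q n * (1 - q * q ^ n)))"
      by (simp add: qpoch_Suc power_mult_distrib algebra_simps flip: diff_divide_distrib)
    ultimately show ?thesis by simp
  qed
  ultimately have "(\<lambda>n. x * (x ^ n / qpoch q q n)) sums (qexp q x - qexp q (x * q))"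
    by simp
  moreover have "(\<lambda>n. x * (x ^ n / qpoch q q n)) sums (x * qexp q x)"
    by (intro sums_mult qexp_sums x q)
  ultimately have "qexp q x - qexp q (x * q) = x * qexp q x" by (rule sums_unique2)
  then show ?thesis by (simp add: algebra_simps)
qed

lemma qexp_mult_power:
  assumes x: "norm x < 1" and q: "norm q < 1"
  shows "qexp q (x * q ^ n) = qpoch x q n * qexp q x"
proof (induction n)
  case (Suc n)
  have "qexp q (x * q ^ Suc n) = qexp q (x * q ^ n * q)" by (simp add: mult_ac)
  also have "\<dots> = (1 - x * q ^ n) * qexp q (x * q ^ n)"
    by (intro qexp_mult_q norm_mult_power_less_1 x q)
  finally show ?case using Suc by (simp add: qpoch_Suc mult_ac)
qed simp

text \<open>A power series is continuous at 0, and the constant term is 1 here.\<close>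

lemma qexp_tendsto_1:
  assumes x: "norm x < 1" and q: "norm q < 1"
  shows "(\<lambda>n. qexp q (x * q ^ n)) \<longlonglongrightarrow> 1"
proof -
  have "(qexp q \<longlongrightarrow> 1 / qpoch q q 0) (at 0)"
  proof (rule powser_limit_0_strong[where s = 1])
    fix y :: complex assume "y \<noteq> 0" "norm y < 1"
    then show "(\<lambda>n. (1 / qpoch q q n) * y ^ n) sums qexp q y"
      using qexp_sums[OF _ q, of y] by simp
  qed simp
  moreover have "qexp q 0 = 1"
    using powser_zero[of "\<lambda>n. 1 / qpoch q q n"] by (simp add: qexp_def)
  ultimately have "isCont (qexp q) 0" by (simp add: isCont_def)
  moreover have "(\<lambda>n. x * q ^ n) \<longlonglongrightarrow> 0"
    using tendsto_mult[OF tendsto_const[of x] LIMSEQ_power_zero[OF q]] by simp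
  ultimately show ?thesis using \<open>qexp q 0 = 1\<close> isCont_tendsto_compose by metis
qed

text \<open>For \<open>norm w \<le> 1\<close> and \<open>norm q < 1\<close> this is \<open>(q)\<^sub>\<infinity> / (w q)\<^sub>\<infinity>\<close>; elsewhere the limit need not exist.\<close>

definition qratio :: "complex \<Rightarrow> complex \<Rightarrow> complex" where
  "qratio w q = lim (\<lambda>N. qpoch q q N / qpoch (w * q) q N)"

text \<open>By the functional equation \<open>1 / (w q)\<^sub>N\<close> is
  \<open>qexp q (w * q) / qexp q (w * q * q ^ N)\<close>, whose denominator tends to 1. Both
  sequences thus converge to \<open>(q)\<^sub>\<infinity>\<close> times
  \<open>qexp q (w * q)\<close>.\<close>

lemma qratio_limits:
  assumes w: "norm w \<le> 1" and q: "norm q < 1"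
  shows qratio_tendsto: "(\<lambda>N. qpoch q q N / qpoch (w * q) q N) \<longlonglongrightarrow> qratio w q"
    and qratio_tendsto_sum:
      "(\<lambda>N. qpoch q q N * (\<Sum>n\<le>N. (w * q) ^ n / qpoch q q n)) \<longlonglongrightarrow> qratio w q"
proof -
  have wq: "norm (w * q) < 1"
    using w q by (metis mult_left_le_one_le norm_ge_zero norm_mult order_le_less_trans)
  obtain P where P: "qpoch q q \<longlonglongrightarrow> P"
    using qpoch_tendsto_nonzero q by metis
  have "(\<lambda>N. qpoch q q N * (qexp q (w * q) / qexp q (w * q * q ^ N)))
          \<longlonglongrightarrow> P * (qexp q (w * q) / 1)"
    by (intro tendsto_intros P qexp_tendsto_1 wq q) simp
  moreover have "\<forall>\<^sub>F N in sequentially.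
      qpoch q q N * (qexp q (w * q) / qexp q (w * q * q ^ N)) = qpoch q q N / qpoch (w * q) q N"
  proof -
    \<comment> \<open>A single \<open>N\<close> with a nonzero value already forces
      \<open>qexp q (w * q) \<noteq> 0\<close> by \<open>qexp_mult_power\<close>, which is what the
      cancellation needs.\<close>
    have "\<forall>\<^sub>F N in sequentially. qexp q (w * q * q ^ N) \<noteq> 0"
      using qexp_tendsto_1[OF wq q] by (rule tendsto_imp_eventually_ne) simp
    then show ?thesis
      by (rule eventually_mono) (auto simp: qexp_mult_power[OF wq q])
  qed
  ultimately have lim: "(\<lambda>N. qpoch q q N / qpoch (w * q) q N) \<longlonglongrightarrow> P * qexp q (w * q)"
    by (simp add: tendsto_cong)
  then have R: "qratio w q = P * qexp q (w * q)"
    by (simp add: qratio_def limI)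
  show "(\<lambda>N. qpoch q q N / qpoch (w * q) q N) \<longlonglongrightarrow> qratio w q"
    using lim R by simp
  show "(\<lambda>N. qpoch q q N * (\<Sum>n\<le>N. (w * q) ^ n / qpoch q q n)) \<longlonglongrightarrow> qratio w q"
    unfolding R using qexp_sums[OF wq q]
    by (intro tendsto_mult P) (simp add: sums_def_le)
qed

section \<open>Decay of the quotients along a radius\<close>

text \<open>Real part of the Taylor series of the logarithm. The term for \<open>l = 0\<close> is 0
  by the convention for division by 0.\<close>

lemma ln_norm_one_minus_sums:
  fixes x :: complex
  assumes "norm x < 1"
  shows "(\<lambda>l. Re (x ^ l) / real l) sums (- ln (norm (1 - x)))"
proof -
  have nz: "1 - x \<noteq> 0" using assms by auto
  have "(\<lambda>n. (-1) ^ Suc n / of_nat n * (- x) ^ n) sums ln (1 + - x)"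
    using assms by (intro Ln_series) simp
  then have "(\<lambda>n. Re ((-1) ^ Suc n / of_nat n * (- x) ^ n)) sums Re (ln (1 - x))"
    using sums_Re by fastforce
  then have "(\<lambda>n. - Re ((-1) ^ Suc n / of_nat n * (- x) ^ n)) sums (- ln (norm (1 - x)))"
    using nz by (intro sums_minus) simp
  moreover have "- Re ((-1) ^ Suc n / of_nat n * (- x) ^ n) = Re (x ^ n) / real n" for n
  proof -
    have "(-1) ^ Suc n / of_nat n * (- x) ^ n = - (x ^ n / of_nat n)"
      by (cases "even n") auto
    then show ?thesis by (simp only: uminus_complex.sel Re_divide_of_nat minus_minus)
  qed
  ultimately show ?thesis by (simp only:)
qed

text \<open>Moving from \<open>u\<close> to \<open>s * u\<close> costs \<open>1 - s\<close>, which
  is itself at most the distance from 1 to \<open>s * u\<close>. Hence a lower bound on the unit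
  circle carries over to the radius, uniformly in \<open>s\<close>.\<close>

lemma norm_one_minus_le_twice:
  fixes u :: complex
  assumes "norm u = 1" "0 \<le> s" "s \<le> 1"
  shows "norm (1 - u) \<le> 2 * norm (1 - of_real s * u)"
proof -
  have "norm (1 - u) \<le> norm (1 - of_real s * u) + norm (of_real s * u - u)"
    using norm_triangle_ineq[of "1 - of_real s * u" "of_real s * u - u"] by simp
  also have "norm (of_real s * u - u) = norm (of_real (s - 1) * u)"
    by (simp add: algebra_simps)
  also have "\<dots> = 1 - s"
    using assms by (simp only: norm_mult norm_of_real) simp
  also have "1 - s \<le> norm (1 - of_real s * u)"
    using norm_triangle_ineq2[of 1 "of_real s * u"] assms by (simp add: norm_mult)
  finally show ?thesis by simp
qed

text \<open>The closed form bounds the sum independently of \<open>N\<close>. The factor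
  \<open>norm x\<close> is retained so that the later sum over \<open>l\<close> is the logarithm
  series in \<open>s\<close>.\<close>

lemma norm_geometric_sum_le:
  fixes x :: complex
  assumes "norm x < 1" "0 < d" "d \<le> norm (1 - x)"
  shows "norm (\<Sum>k<N. x ^ Suc k) \<le> 2 * norm x / d"
proof -
  have "x \<noteq> 1" using assms by auto
  have "(\<Sum>k<N. x ^ Suc k) = x * (\<Sum>k<N. x ^ k)" by (simp add: sum_distrib_left)
  also have "\<dots> = x * ((1 - x ^ N) / (1 - x))"
    using \<open>x \<noteq> 1\<close> by (simp add: sum_gp_strict)
  finally have "norm (\<Sum>k<N. x ^ Suc k) = norm x * norm (1 - x ^ N) / norm (1 - x)"
    by (simp add: norm_mult norm_divide)
  also have "\<dots> \<le> norm x * 2 / d"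
  proof (intro frac_le mult_left_mono)
    have "norm (1 - x ^ N) \<le> 1 + norm x ^ N"
      using norm_triangle_ineq4[of 1 "x ^ N"] by (simp add: norm_power)
    then show "norm (1 - x ^ N) \<le> 2"
      using power_le_one[of "norm x" N] assms by simp
  qed (use assms in auto)
  finally show ?thesis by (simp add: mult_ac)
qed

lemma primitive_root_norm:
  assumes "primitive_root_of_unity m \<zeta>"
  shows "norm \<zeta> = 1"
proof -
  have "norm \<zeta> ^ m = 1" "0 < m"
    using assms by (simp_all add: primitive_root_of_unity_def flip: norm_power)
  then show ?thesis using power_eq_imp_eq_base[of "norm \<zeta>" m 1] by simp
qed

lemma primitive_root_separation:
  assumes "primitive_root_of_unity m \<zeta>"
  obtains c where "0 < c" "\<And>l. \<not> m dvd l \<Longrightarrow> c \<le> norm (1 - \<zeta> ^ l)"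
proof -
  have m: "0 < m" and 1: "\<zeta> ^ m = 1" and ne: "\<And>k. 0 < k \<Longrightarrow> k < m \<Longrightarrow> \<zeta> ^ k \<noteq> 1"
    using assms by (auto simp: primitive_root_of_unity_def)
  \<comment> \<open>Powers of \<open>\<zeta>\<close> depend only on the exponent modulo
    \<open>m\<close>, so finitely many distances occur. The inserted 1 keeps the set nonempty for
    \<open>m = 1\<close>.\<close>
  define c where "c = Min (insert 1 ((\<lambda>k. norm (1 - \<zeta> ^ k)) ` {0<..<m}))"
  have "0 < c" using ne by (auto simp: c_def)
  moreover have "c \<le> norm (1 - \<zeta> ^ l)" if "\<not> m dvd l" for l
  proof -
    have "\<zeta> ^ l = \<zeta> ^ (m * (l div m) + l mod m)" by simp
    also have "\<dots> = \<zeta> ^ (l mod m)" by (simp only: power_add power_mult 1) simp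
    finally have "\<zeta> ^ l = \<zeta> ^ (l mod m)" .
    moreover have "l mod m \<in> {0<..<m}" using that m by (auto simp: dvd_eq_mod_eq_0)
    ultimately show ?thesis by (auto simp: c_def intro!: Min_le)
  qed
  ultimately show ?thesis using that by blast
qed

text \<open>The logarithmic estimate is carried out for the finite products, with a bound that still
  depends on \<open>N\<close> through the geometric sum belonging to \<open>l = m\<close>.\<close>

lemma qratio_partial_bound:
  assumes prim: "primitive_root_of_unity m \<zeta>"
    and c: "0 < c" "\<And>l. \<not> m dvd l \<Longrightarrow> c \<le> norm (1 - \<zeta> ^ l)"
    and w: "norm w \<le> 1" and s: "0 < s" "s < 1"
  defines "q \<equiv> of_real s * \<zeta>"
  shows "norm (qpoch q q N / qpoch (w * q) q N)
    \<le> exp (- (Re (1 - w ^ m) / m * (\<Sum>k<N. (s ^ m) ^ Suc k)) - 8 / c * ln (1 - s))"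
proof -
  have m: "0 < m" and \<zeta>m: "\<zeta> ^ m = 1"
    using prim by (auto simp: primitive_root_of_unity_def)
  have n\<zeta>: "norm \<zeta> = 1" using prim by (rule primitive_root_norm)
  have nq: "norm q = s" using s by (simp add: q_def norm_mult n\<zeta>)
  have nwq: "norm (w * q) < 1"
    using le_less_trans[OF mult_left_le_one_le[OF _ _ w] s(2)] s(1) by (simp add: norm_mult nq)
  \<comment> \<open>\<open>T l\<close> collects the \<open>l\<close>-th terms of the logarithm
    series of all \<open>N\<close> factors. As \<open>N\<close> is finite, exchanging the summations
    only adds finitely many convergent series.\<close>
  define T where "T l = (\<Sum>k<N. Re ((q ^ Suc k) ^ l) / l - Re ((w * q ^ Suc k) ^ l) / l)" for l :: nat
  \<comment> \<open>A termwise minorant of \<open>T\<close>: the main term sits at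
    \<open>l = m\<close>, and the error allowed when \<open>m\<close> does not divide
    \<open>l\<close> is subtracted for every \<open>l\<close>, so that its sum is a multiple of
    \<open>ln (1 - s)\<close>.\<close>
  define d where "d l = (if l = m then Re (1 - w ^ m) / m * (\<Sum>k<N. (s ^ m) ^ Suc k) else 0)
      + (- (8 / c)) * (s ^ l / l)" for l :: nat
  have less: "norm (q ^ Suc k) < 1" "norm (w * q ^ Suc k) < 1" for k
    using norm_mult_power_less_1[of q q k] norm_mult_power_less_1[of "w * q" q k] nq nwq s
    by (simp_all add: mult.assoc)
  have Tsums: "T sums (\<Sum>k<N. - ln (norm (1 - q ^ Suc k)) - - ln (norm (1 - w * q ^ Suc k)))"
    unfolding T_def by (intro sums_sum sums_diff ln_norm_one_minus_sums less)
  have "(\<lambda>l. Re (of_real s ^ l) / l) sums (- ln (norm (1 - of_real s :: complex)))"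
    using s by (intro ln_norm_one_minus_sums) simp
  moreover have "norm (1 - of_real s :: complex) = 1 - s"
    using s by (metis abs_of_pos diff_gt_0_iff_gt norm_of_real of_real_1 of_real_diff)
  ultimately have "(\<lambda>l. s ^ l / l) sums (- ln (1 - s))"
    by (simp flip: of_real_power)
  then have dsums: "d sums (Re (1 - w ^ m) / m * (\<Sum>k<N. (s ^ m) ^ Suc k) + (- (8 / c)) * (- ln (1 - s)))"
    unfolding d_def by (intro sums_add sums_mult sums_single)
  have T_eq: "T l = Re ((1 - w ^ l) * (\<Sum>k<N. (q ^ l) ^ Suc k)) / l" for l
  proof -
    have "T l = (\<Sum>k<N. Re ((1 - w ^ l) * (q ^ l) ^ Suc k) / l)"
      unfolding T_def diff_divide_distrib[symmetric] minus_complex.sel[symmetric]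
      by (intro sum.cong refl)
        (simp only: power_mult_distrib power_mult[symmetric] mult.commute[of l] left_diff_distrib mult_1)
    then show ?thesis by (simp only: sum_divide_distrib Re_sum sum_distrib_left)
  qed
  have "d l \<le> T l" for l
  proof (cases "m dvd l")
    case True
    \<comment> \<open>Here \<open>\<zeta> ^ l = 1\<close>, so \<open>q ^ l\<close> is a positive
      real number and only the sign of \<open>Re (1 - w ^ l)\<close> matters. The index
      \<open>l = 0\<close> belongs to this case and contributes 0.\<close>
    then obtain i where i: "l = m * i" by blast
    have ql: "q ^ l = of_real (s ^ l)"
      by (simp add: q_def power_mult_distrib i power_mult \<zeta>m)
    have "T l = Re (1 - w ^ l) * (\<Sum>k<N. (s ^ l) ^ Suc k) / l"
      unfolding T_eq ql of_real_power[symmetric] of_real_sum[symmetric]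
      by (simp del: of_real_power of_real_sum)
    moreover have "0 \<le> Re (1 - w ^ l) * (\<Sum>k<N. (s ^ l) ^ Suc k) / l"
    proof -
      have "Re (w ^ l) \<le> norm (w ^ l)" by (rule complex_Re_le_cmod)
      also have "\<dots> \<le> 1" using w by (simp add: norm_power power_le_one)
      finally show ?thesis using s by (auto intro!: divide_nonneg_nonneg mult_nonneg_nonneg sum_nonneg)
    qed
    moreover have "0 \<le> 8 / c * (s ^ l / l)" using s c(1) by simp
    ultimately show ?thesis by (auto simp: d_def)
  next
    case False
    then have l: "0 < l" by (cases l) auto
    have nql: "norm (q ^ l) = s ^ l" by (simp add: norm_power nq)
    have "norm (1 - \<zeta> ^ l) \<le> 2 * norm (1 - of_real (s ^ l) * \<zeta> ^ l)"
      using s by (intro norm_one_minus_le_twice) (auto simp: norm_power n\<zeta> power_le_one)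
    then have "c / 2 \<le> norm (1 - q ^ l)"
      using c(2)[OF False] by (simp add: q_def power_mult_distrib)
    then have "norm (\<Sum>k<N. (q ^ l) ^ Suc k) \<le> 2 * norm (q ^ l) / (c / 2)"
      using s l c(1) by (intro norm_geometric_sum_le) (auto simp: nql power_less_one_iff)
    moreover have "norm (1 - w ^ l) \<le> 2"
    proof -
      have "norm (1 - w ^ l) \<le> 1 + norm w ^ l"
        using norm_triangle_ineq4[of 1 "w ^ l"] by (simp add: norm_power)
      then show ?thesis using power_le_one[of "norm w" l] w by simp
    qed
    \<comment> \<open>Source of the constant \<open>8 / c\<close>: a factor 2 from
      \<open>1 - w ^ l\<close> and a factor \<open>2 / (c / 2)\<close> from the geometric
      sum.\<close>
    ultimately have "norm ((1 - w ^ l) * (\<Sum>k<N. (q ^ l) ^ Suc k)) \<le> 2 * (2 * norm (q ^ l) / (c / 2))"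
      unfolding norm_mult by (intro mult_mono) auto
    then have "- (8 / c * s ^ l) \<le> Re ((1 - w ^ l) * (\<Sum>k<N. (q ^ l) ^ Suc k))"
      using abs_Re_le_cmod[of "(1 - w ^ l) * (\<Sum>k<N. (q ^ l) ^ Suc k)"] by (simp add: nql)
    then have "- (8 / c * s ^ l) / l \<le> T l"
      unfolding T_eq by (rule divide_right_mono) simp
    then show ?thesis using False by (auto simp: d_def)
  qed
  then have "Re (1 - w ^ m) / m * (\<Sum>k<N. (s ^ m) ^ Suc k) + (- (8 / c)) * (- ln (1 - s))
      \<le> (\<Sum>k<N. - ln (norm (1 - q ^ Suc k)) - - ln (norm (1 - w * q ^ Suc k)))"
    using dsums Tsums sums_le by blast
  also have "\<dots> = - ln (norm (qpoch q q N / qpoch (w * q) q N))"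
  proof -
    have nz: "1 - q ^ Suc k \<noteq> 0" "1 - w * q ^ Suc k \<noteq> 0" for k
      using less[of k] by auto
    have "norm (qpoch q q N / qpoch (w * q) q N)
        = (\<Prod>k<N. norm (1 - q ^ Suc k) / norm (1 - w * q ^ Suc k))"
      by (simp add: qpoch_def norm_divide prod_norm[symmetric] prod_dividef mult.assoc)
    also have "ln \<dots> = (\<Sum>k<N. ln (norm (1 - q ^ Suc k) / norm (1 - w * q ^ Suc k)))"
      using nz by (intro ln_prod) (auto simp del: power_Suc)
    also have "\<dots> = (\<Sum>k<N. ln (norm (1 - q ^ Suc k)) - ln (norm (1 - w * q ^ Suc k)))"
      using nz by (intro sum.cong refl ln_divide_pos) (auto simp del: power_Suc)
    finally show ?thesis by (simp add: sum_negf[symmetric] del: power_Suc)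
  qed
  finally have "ln (norm (qpoch q q N / qpoch (w * q) q N))
      \<le> - (Re (1 - w ^ m) / m * (\<Sum>k<N. (s ^ m) ^ Suc k)) - 8 / c * ln (1 - s)"
    by simp
  moreover have "norm (qpoch q q N / qpoch (w * q) q N) > 0"
    using qpoch_nonzero[of q q N] qpoch_nonzero[of "w * q" q N] nwq nq s by simp
  ultimately show ?thesis by (metis exp_le_cancel_iff exp_ln)
qed

text \<open>As \<open>N\<close> grows, the geometric sum tends to
  \<open>1 / (1 - s ^ m) - 1\<close>, and Bernoulli's inequality replaces \<open>1 - s ^ m\<close>
  by \<open>m * (1 - s)\<close>.\<close>

lemma qratio_bound:
  assumes prim: "primitive_root_of_unity m \<zeta>"
    and c: "0 < c" "\<And>l. \<not> m dvd l \<Longrightarrow> c \<le> norm (1 - \<zeta> ^ l)"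
    and w: "norm w \<le> 1" and s: "0 < s" "s < 1"
  shows "norm (qratio w (of_real s * \<zeta>))
    \<le> exp (- (Re (1 - w ^ m) / m * (1 / (m * (1 - s)) - 1)) - 8 / c * ln (1 - s))"
proof -
  have m: "0 < m" using prim by (simp add: primitive_root_of_unity_def)
  have nq: "norm (of_real s * \<zeta>) < 1"
    using s primitive_root_norm[OF prim] by (simp add: norm_mult)
  have sm: "0 \<le> s ^ m" "s ^ m < 1" using s m by (simp_all add: power_less_one_iff)
  have "(\<lambda>k. s ^ m * (s ^ m) ^ k) sums (s ^ m * (1 / (1 - s ^ m)))"
    using sm by (intro sums_mult geometric_sums) simp
  then have geo: "(\<lambda>N. \<Sum>k<N. (s ^ m) ^ Suc k) \<longlonglongrightarrow> s ^ m * (1 / (1 - s ^ m))"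
    by (simp add: sums_def)
  have "norm (qratio w (of_real s * \<zeta>))
      \<le> exp (- (Re (1 - w ^ m) / m * (s ^ m * (1 / (1 - s ^ m)))) - 8 / c * ln (1 - s))"
  proof (rule LIMSEQ_le)
    show "(\<lambda>N. norm (qpoch (of_real s * \<zeta>) (of_real s * \<zeta>) N
        / qpoch (w * (of_real s * \<zeta>)) (of_real s * \<zeta>) N))
      \<longlonglongrightarrow> norm (qratio w (of_real s * \<zeta>))"
      using w nq by (intro tendsto_norm qratio_tendsto)
    show "(\<lambda>N. exp (- (Re (1 - w ^ m) / m * (\<Sum>k<N. (s ^ m) ^ Suc k)) - 8 / c * ln (1 - s)))
      \<longlonglongrightarrow> exp (- (Re (1 - w ^ m) / m * (s ^ m * (1 / (1 - s ^ m)))) - 8 / c * ln (1 - s))"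
      by (intro tendsto_intros geo)
  qed (use qratio_partial_bound[OF prim c w s] in blast)
  also have "\<dots> \<le> exp (- (Re (1 - w ^ m) / m * (1 / (m * (1 - s)) - 1)) - 8 / c * ln (1 - s))"
  proof -
    have "1 - s ^ m \<le> m * (1 - s)"
      using Bernoulli_inequality[of "s - 1" m] s by (simp add: algebra_simps)
    then have "1 / (m * (1 - s)) \<le> 1 / (1 - s ^ m)"
      using sm by (intro divide_left_mono) auto
    also have "\<dots> = s ^ m * (1 / (1 - s ^ m)) + 1"
      using sm by (simp add: field_simps)
    finally have "1 / (m * (1 - s)) - 1 \<le> s ^ m * (1 / (1 - s ^ m))" by simp
    moreover have "0 \<le> Re (1 - w ^ m) / m"
    proof -
      have "Re (w ^ m) \<le> norm (w ^ m)" by (rule complex_Re_le_cmod)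
      also have "\<dots> \<le> 1" using w by (simp add: norm_power power_le_one)
      finally show ?thesis by simp
    qed
    ultimately have "Re (1 - w ^ m) / m * (1 / (m * (1 - s)) - 1)
        \<le> Re (1 - w ^ m) / m * (s ^ m * (1 / (1 - s ^ m)))"
      by (rule mult_left_mono)
    then show ?thesis by simp
  qed
  finally show ?thesis .
qed

text \<open>Serves in contrapositive form, to make the coefficient \<open>Re (1 - w ^ m)\<close> of
  the main term strictly positive.\<close>

lemma complex_eq_1_if_Re_ge_1:
  assumes "norm z \<le> 1" "1 \<le> Re z"
  shows "z = 1"
proof -
  have "(Re z)\<^sup>2 + (Im z)\<^sup>2 \<le> 1"
    using assms(1) by (simp flip: cmod_power2 add: power_le_one)
  moreover have "1 \<le> (Re z)\<^sup>2" using assms(2) by (simp add: one_le_power)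
  ultimately have "(Im z)\<^sup>2 \<le> 0" by linarith
  then have "Im z = 0" by simp
  moreover have "Re z = 1" using assms complex_Re_le_cmod[of z] by simp
  ultimately show ?thesis by (simp add: complex_eq_iff)
qed

text \<open>In the exponent the negative multiple of \<open>1 / (1 - s)\<close> outweighs the
  logarithm. Admitting \<open>norm w < 1\<close> covers \<open>w = 0\<close>, that is, the decay of
  \<open>(q)\<^sub>\<infinity>\<close> itself.\<close>

lemma qratio_radial_limit:
  assumes prim: "primitive_root_of_unity m \<zeta>"
    and w: "norm w \<le> 1" "w ^ m \<noteq> 1"
  shows "((\<lambda>s. qratio w (of_real s * \<zeta>)) \<longlongrightarrow> 0) (at_left 1)"
proof -
  obtain c where c: "0 < c" "\<And>l. \<not> m dvd l \<Longrightarrow> c \<le> norm (1 - \<zeta> ^ l)"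
    using primitive_root_separation[OF prim] by blast
  have m: "0 < real m" using prim by (simp add: primitive_root_of_unity_def)
  have "norm (w ^ m) \<le> 1" using w by (simp add: norm_power power_le_one)
  then have "\<not> 1 \<le> Re (w ^ m)" using complex_eq_1_if_Re_ge_1 w by blast
  then have b: "0 < Re (1 - w ^ m) / m" using m by simp
  \<comment> \<open>With opaque constants the asymptotic claim depends on nothing but their
    signs.\<close>
  define b C M where "b = Re (1 - w ^ m) / m" and "C = 8 / c" and "M = real m"
  have "((\<lambda>s. exp (- (b * (1 / (M * (1 - s)) - 1)) - C * ln (1 - s))) \<longlongrightarrow> 0) (at_left 1)"
  proof -
    have "0 < b" "0 < C" "0 < M" using b c m by (simp_all add: b_def C_def M_def)
    then show ?thesis by real_asymp
  qed
  moreover have "\<forall>\<^sub>F s in at_left 1. norm (qratio w (of_real s * \<zeta>))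
      \<le> exp (- (b * (1 / (M * (1 - s)) - 1)) - C * ln (1 - s))"
    unfolding b_def C_def M_def using qratio_bound[OF prim c w(1)]
    by (auto simp: eventually_at_left_real intro!: eventually_at_leftI[of 0])
  ultimately show ?thesis by (rule Lim_null_comparison[rotated])
qed

section \<open>The series as a limit of finite sums over sets of parts\<close>

text \<open>
  Partitions with a repeated part contribute 0 to the series, so the remaining ones are encoded as
  finite sets of positive integers.
\<close>

definition part_sets :: "nat set \<Rightarrow> nat set set" where
  "part_sets S = {A. finite A \<and> A \<noteq> {} \<and> 0 \<notin> A \<and> Min A \<in> S}"

definition signed_term :: "complex \<Rightarrow> nat set \<Rightarrow> complex" where
  "signed_term q A = - ((-1) ^ card A) * q ^ \<Sum>A"

lemma F_series_eq_part_sets: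
  "F_series S q = (\<Sum>\<^sub>\<infinity>A\<in>part_sets S. signed_term q A)"
proof -
  let ?P = "{p \<in> partitions. p \<noteq> {#} \<and> smallest_part p \<in> S}"
  have inj: "inj_on mset_set (part_sets S)"
    by (auto simp: inj_on_def part_sets_def mset_set_eq_iff)
  have val: "of_int (partition_mu_star (mset_set A)) * q ^ \<Sum>\<^sub># (mset_set A) = signed_term q A"
    if "A \<in> part_sets S" for A
  proof -
    have "\<not> 2 \<le> count (mset_set A) k" for k
      by (cases "k \<in> A \<and> finite A") (auto simp: count_mset_set')
    then show ?thesis using that
      by (auto simp: partition_mu_star_def partition_mu_def signed_term_def part_sets_def
          sum_unfold_sum_mset mset_set_empty_iff)
  qed
  have "F_series S q = (\<Sum>\<^sub>\<infinity>p\<in>mset_set ` part_sets S.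
      of_int (partition_mu_star p) * q ^ \<Sum>\<^sub># p)"
    unfolding F_series_def
  proof (rule infsum_cong_neutral)
    fix p assume p: "p \<in> ?P - mset_set ` part_sets S"
    \<comment> \<open>Otherwise all multiplicities are at most 1, and \<open>p\<close> is the image
      of its own set of parts.\<close>
    have "\<exists>k. 2 \<le> count p k"
    proof (rule ccontr)
      assume "\<nexists>k. 2 \<le> count p k"
      then have "count p k = (if k \<in># p then 1 else 0)" for k
        by (metis One_nat_def Suc_1 count_eq_zero_iff less_Suc_eq_le linorder_not_le not_less_eq_eq order_antisym_conv zero_order(1))
      then have "p = mset_set (set_mset p)"
        by (intro multiset_eqI) (simp add: count_mset_set')
      moreover have "set_mset p \<in> part_sets S"
        using p by (auto simp: part_sets_def partitions_def smallest_part_def)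
      ultimately show False using p by blast
    qed
    then show "of_int (partition_mu_star p) * q ^ \<Sum>\<^sub># p = 0"
      using p by (simp add: partition_mu_star_def partition_mu_def)
  next
    fix p assume "p \<in> mset_set ` part_sets S - ?P"
    then show "of_int (partition_mu_star p) * q ^ \<Sum>\<^sub># p = 0"
      by (auto simp: part_sets_def partitions_def smallest_part_def mset_set_empty_iff
          intro: gr0I)
  qed auto
  also have "\<dots> = (\<Sum>\<^sub>\<infinity>A\<in>part_sets S. signed_term q A)"
    using val by (simp add: infsum_reindex[OF inj] o_def cong: infsum_cong)
  finally show ?thesis .
qed

text \<open>The sum expands the product of the factors \<open>1 + x ^ k\<close>, each at most
  \<open>exp (x ^ k)\<close>. The bound is uniform in \<open>N\<close>, as absolute summability
  requires.\<close>

lemma sum_Pow_power_le: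
  fixes x :: real
  assumes "0 \<le> x" "x < 1"
  shows "(\<Sum>A\<in>Pow {1..N}. x ^ \<Sum>A) \<le> exp (1 / (1 - x))"
proof -
  have "(\<Sum>A\<in>Pow {1..N}. x ^ \<Sum>A) = (\<Prod>k\<in>{1..N}. x ^ k + 1)"
    by (subst prod_add) (simp_all add: power_sum)
  also have "\<dots> \<le> (\<Prod>k\<in>{1..N}. exp (x ^ k))"
    using assms by (intro prod_mono) (simp add: exp_ge_add_one_self add.commute)
  also have "\<dots> = exp (\<Sum>k\<in>{1..N}. x ^ k)" by (simp add: exp_sum)
  also have "(\<Sum>k\<in>{1..N}. x ^ k) \<le> 1 / (1 - x)"
    using sum_le_suminf[of "\<lambda>k. x ^ k" "{1..N}"] assms
    by (simp add: suminf_geometric summable_geometric)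
  finally show ?thesis by simp
qed

text \<open>Every finite family of finite sets of positive integers lies in some
  \<open>Pow {1..N}\<close>, where the preceding bound applies.\<close>

lemma signed_term_summable:
  assumes "norm q < 1"
  shows "signed_term q summable_on part_sets S"
proof (rule abs_summable_summable, rule nonneg_bdd_above_summable_on)
  show "bdd_above (sum (\<lambda>A. norm (signed_term q A)) ` {F. F \<subseteq> part_sets S \<and> finite F})"
  proof (intro bdd_aboveI2)
    fix F assume F: "F \<in> {F. F \<subseteq> part_sets S \<and> finite F}"
    then have "finite (\<Union>F)" by (auto simp: part_sets_def)
    then obtain N where N: "\<Union>F \<subseteq> {..N}" using finite_nat_iff_bounded_le by blast
    moreover have "0 \<notin> \<Union>F" using F by (auto simp: part_sets_def)
    ultimately have "\<Union>F \<subseteq> {1..N}" using not_less_eq_eq by fastforce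
    then have "(\<Sum>A\<in>F. norm (signed_term q A)) \<le> (\<Sum>A\<in>Pow {1..N}. norm (signed_term q A))"
      by (intro sum_mono2) auto
    also have "\<dots> \<le> exp (1 / (1 - norm q))"
      using sum_Pow_power_le[of "norm q" N] assms
      by (simp add: signed_term_def norm_mult norm_power)
    finally show "(\<Sum>A\<in>F. norm (signed_term q A)) \<le> exp (1 / (1 - norm q))" .
  qed
qed simp

lemma signed_term_partial_sum:
  assumes "norm q < 1"
  shows "(\<Sum>A\<in>Pow {1..N} \<inter> part_sets S. signed_term q A)
    = qpoch q q N * (\<Sum>n\<in>{1..N} \<inter> S. q ^ n / qpoch q q n)"
proof (induction N)
  case 0
  then show ?case by (simp add: part_sets_def)
next
  case (Suc N)
  let ?M = "Suc N"
  let ?D = "Pow {1..N} \<inter> part_sets S"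
  let ?E = "if ?M \<in> S then {{?M}} else {}"
  have "Pow {1..?M} \<inter> part_sets S = ?D \<union> (insert ?M ` ?D \<union> ?E)"
    (is "?L = ?R")
  proof (intro equalityI subsetI)
    fix A assume A: "A \<in> ?L"
    then have fin: "finite A" by (simp add: part_sets_def)
    show "A \<in> ?R"
    proof (cases "?M \<in> A")
      case False
      then have "A \<subseteq> {1..N}" using A by (auto simp: le_Suc_eq)
      then show ?thesis using A by blast
    next
      case True
      define B where "B = A - {?M}"
      have AB: "A = insert ?M B" using True by (auto simp: B_def)
      have sub: "B \<subseteq> {1..N}" using A by (auto simp: B_def le_Suc_eq)
      show ?thesis
      proof (cases "B = {}")
        case True
        then show ?thesis using A AB by (auto simp: part_sets_def)
      next
        case False
        have finB: "finite B" using sub finite_subset by blast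
        \<comment> \<open>The inserted element exceeds all of \<open>B\<close>, so membership of the
          minimum in \<open>S\<close> is unaffected.\<close>
        have "Min B \<le> N" using sub Min_in[OF finB False] by auto
        then have "Min A = Min B" using AB finB False by (simp add: Min_insert min_def del: Min_le_iff Min_ge_iff Min_gr_iff Min_less_iff)
        then have "B \<in> ?D" using A AB sub finB False by (auto simp: part_sets_def)
        then show ?thesis using AB by blast
      qed
    qed
  next
    fix A assume "A \<in> ?R"
    then consider "A \<in> ?D" | B where "B \<in> ?D" "A = insert ?M B" | "A = {?M}" "?M \<in> S"
      by (auto split: if_splits)
    then show "A \<in> ?L"
    proof cases
      case 2
      then have B: "finite B" "B \<noteq> {}" "B \<subseteq> {1..N}" by (auto simp: part_sets_def)
      have "Min B \<le> N" using B(3) Min_in[OF B(1,2)] by fastforce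
      then have "Min A = Min B" using 2 B by (simp add: Min_insert min_def del: Min_le_iff Min_ge_iff Min_gr_iff Min_less_iff)
      then show ?thesis using 2 by (auto simp: part_sets_def le_Suc_eq)
    qed (auto simp: part_sets_def le_Suc_eq)
  qed
  then have "(\<Sum>A\<in>Pow {1..?M} \<inter> part_sets S. signed_term q A)
      = sum (signed_term q) (?D \<union> (insert ?M ` ?D \<union> ?E))" by simp
  also have "\<dots> = sum (signed_term q) ?D + sum (signed_term q) (insert ?M ` ?D \<union> ?E)"
    by (rule sum.union_disjoint) auto
  also have "sum (signed_term q) (insert ?M ` ?D \<union> ?E)
      = sum (signed_term q) (insert ?M ` ?D) + sum (signed_term q) ?E"
  proof (rule sum.union_disjoint)
    have "\<And>B. B \<in> ?D \<Longrightarrow> insert ?M B \<noteq> {?M}"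
      by (auto simp: part_sets_def insert_eq_iff)
    then show "insert ?M ` ?D \<inter> ?E = {}" by auto
  qed auto
  also have "sum (signed_term q) (insert ?M ` ?D) = (\<Sum>B\<in>?D. signed_term q (insert ?M B))"
  proof (subst sum.reindex)
    have "\<And>B. B \<in> ?D \<Longrightarrow> ?M \<notin> B" by auto
    then show "inj_on (insert ?M) ?D" by (metis inj_onI insert_ident)
  qed simp
  also have "\<dots> = (\<Sum>B\<in>?D. - (q ^ ?M) * signed_term q B)"
  proof (rule sum.cong[OF refl])
    fix B assume B: "B \<in> ?D"
    then have "finite B" "?M \<notin> B" by (auto simp: part_sets_def)
    then show "signed_term q (insert ?M B) = - (q ^ ?M) * signed_term q B"
      by (simp add: signed_term_def power_add)
  qed
  also have "\<dots> = - (q ^ ?M) * sum (signed_term q) ?D" by (simp only: sum_distrib_left)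
  also have "sum (signed_term q) ?E = (if ?M \<in> S then q ^ ?M else 0)"
    by (simp add: signed_term_def)
  finally have "(\<Sum>A\<in>Pow {1..?M} \<inter> part_sets S. signed_term q A)
      = (1 - q ^ ?M) * sum (signed_term q) ?D + (if ?M \<in> S then q ^ ?M else 0)"
    by (simp add: algebra_simps)
  also have "\<dots> = qpoch q q ?M * (\<Sum>n\<in>{1..N} \<inter> S. q ^ n / qpoch q q n)
      + (if ?M \<in> S then q ^ ?M else 0)"
    unfolding Suc by (simp add: qpoch_Suc)
  also have "\<dots> = qpoch q q ?M * (\<Sum>n\<in>{1..?M} \<inter> S. q ^ n / qpoch q q n)"
  proof -
    have "{1..?M} \<inter> S = (if ?M \<in> S then insert ?M ({1..N} \<inter> S) else {1..N} \<inter> S)"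
      by (auto simp: le_Suc_eq)
    then show ?thesis using qpoch_nonzero[OF assms assms, of ?M]
      by (simp add: distrib_left del: power_Suc)
  qed
  finally show ?case .
qed

text \<open>The families of sets bounded by \<open>N\<close> eventually contain any given finite
  family, so the unordered sum is the limit along them.\<close>

lemma F_series_limit:
  assumes "norm q < 1"
  shows "(\<lambda>N. qpoch q q N * (\<Sum>n\<in>{1..N} \<inter> S. q ^ n / qpoch q q n)) \<longlonglongrightarrow> F_series S q"
proof -
  have "filterlim (\<lambda>N. Pow {1..N} \<inter> part_sets S) (finite_subsets_at_top (part_sets S)) sequentially"
    unfolding filterlim_finite_subsets_at_top
  proof (intro allI impI)
    fix X assume X: "finite X \<and> X \<subseteq> part_sets S"
    then have "finite (\<Union>X)" by (auto simp: part_sets_def)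
    then obtain K where K: "\<Union>X \<subseteq> {..K}" using finite_nat_iff_bounded_le by blast
    have "finite (Pow {1..N} \<inter> part_sets S) \<and> X \<subseteq> Pow {1..N} \<inter> part_sets S
        \<and> Pow {1..N} \<inter> part_sets S \<subseteq> part_sets S" if "K \<le> N" for N
    proof -
      have "a \<in> {1..N}" if "a \<in> A" "A \<in> X" for a A
      proof -
        have "a \<le> K" "a \<noteq> 0" using X K that by (auto simp: part_sets_def)
        then show ?thesis using \<open>K \<le> N\<close> by auto
      qed
      then show ?thesis using X by blast
    qed
    then show "\<forall>\<^sub>F N in sequentially. finite (Pow {1..N} \<inter> part_sets S)
        \<and> X \<subseteq> Pow {1..N} \<inter> part_sets S \<and> Pow {1..N} \<inter> part_sets S \<subseteq> part_sets S"
      by (auto simp: eventually_sequentially)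
  qed
  with has_sum_infsum[OF signed_term_summable[OF assms]]
  have "(\<lambda>N. sum (signed_term q) (Pow {1..N} \<inter> part_sets S)) \<longlonglongrightarrow> F_series S q"
    unfolding has_sum_def F_series_eq_part_sets by (rule filterlim_compose)
  then show ?thesis by (simp only: signed_term_partial_sum[OF assms])
qed

section \<open>The root-of-unity filter for residue classes\<close>

lemma qratio_1:
  assumes "norm q < 1"
  shows "qratio 1 q = 1"
  using qpoch_nonzero[OF assms assms] by (simp add: qratio_def limI)

lemma qratio_0_tendsto:
  assumes "norm q < 1"
  shows "qpoch q q \<longlonglongrightarrow> qratio 0 q"
  using qratio_tendsto[of 0 q] assms by (simp add: qpoch_def[of 0])

lemma cis_root_power_eq_1_iff:
  assumes "0 < t"
  shows "cis (2 * pi / real t) ^ n = 1 \<longleftrightarrow> t dvd n"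
proof -
  have "cis (2 * pi / real t) ^ n = 1 \<longleftrightarrow> (\<exists>k::int. real n * (2 * pi / t) = of_int k * (2 * pi))"
    unfolding Complex.DeMoivre cis_eq_1_iff by (rule refl)
  also have "\<dots> \<longleftrightarrow> (\<exists>k::int. int n = k * int t)"
  proof (intro ex_cong1)
    fix k :: int
    have "real n * (2 * pi / t) = of_int k * (2 * pi) \<longleftrightarrow> real n = of_int k * real t"
      using assms by (simp add: field_simps)
    also have "\<dots> \<longleftrightarrow> int n = k * int t"
      by (metis of_int_eq_iff of_int_mult of_int_of_nat_eq)
    finally show "real n * (2 * pi / t) = of_int k * (2 * pi) \<longleftrightarrow> int n = k * int t" .
  qed
  also have "\<dots> \<longleftrightarrow> int t dvd int n" by (auto simp: dvd_def mult.commute)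
  finally show ?thesis by simp
qed

text \<open>A geometric sum in \<open>u\<close>, where \<open>u ^ t = 1\<close>. Dividing by
  \<open>(\<omega> ^ j) ^ r\<close> avoids the exponent \<open>n - r\<close>, which is truncated for
  \<open>n < r\<close>.\<close>

lemma sum_roots_of_unity:
  fixes n r :: nat
  assumes "0 < t"
  defines "\<omega> \<equiv> cis (2 * pi / real t)"
  shows "(\<Sum>j<t. (\<omega> ^ j) ^ n / (\<omega> ^ j) ^ r) = (if [n = r] (mod t) then of_nat t else 0)"
proof -
  have nz: "\<omega> \<noteq> 0" by (simp add: \<omega>_def)
  define u where "u = \<omega> ^ n / \<omega> ^ r"
  have "(\<Sum>j<t. (\<omega> ^ j) ^ n / (\<omega> ^ j) ^ r) = (\<Sum>j<t. u ^ j)"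
    by (simp add: u_def power_divide mult.commute flip: power_mult)
  also have "\<dots> = (if u = 1 then of_nat t else 0)"
  proof -
    have "\<omega> ^ t = 1" using cis_root_power_eq_1_iff[OF assms(1), of t] by (simp add: \<omega>_def)
    then have "(\<omega> ^ n) ^ t = 1" "(\<omega> ^ r) ^ t = 1"
      by (metis mult.commute power_mult power_one)+
    then have "u ^ t = 1" by (simp add: u_def power_divide)
    then show ?thesis by (simp add: sum_gp_strict)
  qed
  also have "u = 1 \<longleftrightarrow> [n = r] (mod t)"
  proof (cases "r \<le> n")
    case True
    then have "u = \<omega> ^ (n - r)" using nz by (simp add: u_def power_diff)
    then show ?thesis using True cis_root_power_eq_1_iff[OF assms(1)]
      by (simp add: \<omega>_def cong_altdef_nat)
  next
    case False
    \<comment> \<open>For \<open>n < r\<close> the inverse of \<open>u\<close> is the honest power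
      of \<open>\<omega>\<close>.\<close>
    then have "inverse u = \<omega> ^ (r - n)" using nz by (simp add: u_def power_diff)
    then have "u = 1 \<longleftrightarrow> \<omega> ^ (r - n) = 1" by (metis inverse_1 inverse_inverse_eq)
    then show ?thesis using False cis_root_power_eq_1_iff[OF assms(1)]
      by (simp add: \<omega>_def cong_altdef_nat cong_sym_eq[of n])
  qed
  finally show ?thesis .
qed

text \<open>Euler's sum starts at \<open>n = 0\<close>, whereas a smallest part is positive. If
  \<open>r\<close> is 0 modulo \<open>t\<close>, the surplus term is
  \<open>(q)\<^sub>\<infinity>\<close>, which is \<open>qratio 0 q\<close>.\<close>

lemma F_series_residue_set:
  assumes t: "0 < t" and q: "norm q < 1"
  defines "\<omega> \<equiv> cis (2 * pi / real t)"
  shows "F_series (residue_set r t) q =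
    (\<Sum>j<t. qratio (\<omega> ^ j) q / (\<omega> ^ j) ^ r) / of_nat t
      - (if [0 = r] (mod t) then qratio 0 q else 0)"
proof -
  let ?a = "\<lambda>n. q ^ n / qpoch q q n"
  have norm_pow: "norm (\<omega> ^ j) = 1" for j by (simp add: \<omega>_def norm_power)
  have partial: "qpoch q q N * (\<Sum>n\<in>{1..N} \<inter> residue_set r t. ?a n) =
      (\<Sum>j<t. qpoch q q N * (\<Sum>n\<le>N. (\<omega> ^ j * q) ^ n / qpoch q q n) / (\<omega> ^ j) ^ r) / of_nat t
      - (if [0 = r] (mod t) then qpoch q q N else 0)" for N
  proof -
    have "(\<Sum>j<t. (\<Sum>n\<le>N. (\<omega> ^ j * q) ^ n / qpoch q q n) / (\<omega> ^ j) ^ r)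
        = (\<Sum>n\<le>N. \<Sum>j<t. ?a n * ((\<omega> ^ j) ^ n / (\<omega> ^ j) ^ r))"
      by (subst sum.swap)
        (simp add: sum_divide_distrib power_mult_distrib mult_ac)
    also have "\<dots> = of_nat t * (\<Sum>n\<le>N. if [n = r] (mod t) then ?a n else 0)"
      unfolding sum_distrib_left[symmetric] sum_roots_of_unity[OF t, folded \<omega>_def]
      by (subst sum_distrib_left) (intro sum.cong refl, simp)
    also have "(\<Sum>n\<le>N. if [n = r] (mod t) then ?a n else 0)
        = (if [0 = r] (mod t) then 1 else 0) + (\<Sum>n\<in>{1..N}. if [n = r] (mod t) then ?a n else 0)"
      by (simp add: atMost_atLeast0 sum.atLeast_Suc_atMost)
    also have "(\<Sum>n\<in>{1..N}. if [n = r] (mod t) then ?a n else 0)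
        = (\<Sum>n\<in>{1..N} \<inter> residue_set r t. ?a n)"
      unfolding sum.inter_restrict[OF finite_atLeastAtMost]
      by (intro sum.cong refl) (auto simp: residue_set_def)
    finally have "(\<Sum>n\<in>{1..N} \<inter> residue_set r t. ?a n)
        = (\<Sum>j<t. (\<Sum>n\<le>N. (\<omega> ^ j * q) ^ n / qpoch q q n) / (\<omega> ^ j) ^ r) / of_nat t
          - (if [0 = r] (mod t) then 1 else 0)"
      using t by (simp add: field_simps)
    then show ?thesis
      by (simp add: right_diff_distrib sum_distrib_left)
  qed
  have "(\<lambda>N. (\<Sum>j<t. qpoch q q N * (\<Sum>n\<le>N. (\<omega> ^ j * q) ^ n / qpoch q q n) / (\<omega> ^ j) ^ r) / of_nat t
      - (if [0 = r] (mod t) then qpoch q q N else 0))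
    \<longlonglongrightarrow> (\<Sum>j<t. qratio (\<omega> ^ j) q / (\<omega> ^ j) ^ r) / of_nat t
      - (if [0 = r] (mod t) then qratio 0 q else 0)"
    using t norm_pow qratio_0_tendsto[OF q]
    by (intro tendsto_diff tendsto_divide tendsto_sum qratio_tendsto_sum tendsto_const q)
      (auto simp: \<omega>_def)
  then have "(\<lambda>N. qpoch q q N * (\<Sum>n\<in>{1..N} \<inter> residue_set r t. ?a n))
    \<longlonglongrightarrow> (\<Sum>j<t. qratio (\<omega> ^ j) q / (\<omega> ^ j) ^ r) / of_nat t
      - (if [0 = r] (mod t) then qratio 0 q else 0)"
    by (simp only: partial)
  with F_series_limit[OF q] show ?thesis by (rule LIMSEQ_unique)
qed

section \<open>Passage to the radial limit\<close>

text \<open>On the segment \<open>q\<close> equals \<open>norm q\<close> times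
  \<open>\<zeta>\<close>, and \<open>norm\<close> carries the radial filter to
  \<open>at_left 1\<close>.\<close>

lemma tendsto_radially_to:
  assumes f: "((\<lambda>s. f (of_real s * \<zeta>)) \<longlongrightarrow> L) (at_left 1)" and \<zeta>: "norm \<zeta> = 1"
  shows "(f \<longlongrightarrow> L) (radially_to \<zeta>)"
proof -
  have seg: "norm q < 1 \<and> of_real (norm q) * \<zeta> = q" if "q \<in> open_segment 0 \<zeta>" for q
  proof -
    have "\<exists>u>0. u < 1 \<and> q = of_real u * \<zeta>"
      using that by (simp add: in_segment scaleR_conv_of_real)
    then obtain u where "0 < u" "u < 1" "q = of_real u * \<zeta>" by blast
    then show ?thesis using \<zeta> by (simp add: norm_mult)
  qed
  have ev: "\<forall>\<^sub>F q in radially_to \<zeta>. q \<in> open_segment 0 \<zeta>"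
    by (simp add: radially_to_def eventually_at_filter)
  have "((\<lambda>q. norm q) \<longlongrightarrow> 1) (radially_to \<zeta>)"
    using tendsto_norm[OF tendsto_ident_at, of \<zeta>] \<zeta> by (simp add: radially_to_def)
  moreover have "\<forall>\<^sub>F q in radially_to \<zeta>. norm q \<in> {..<1} \<and> norm q \<noteq> 1"
    using ev by eventually_elim (use seg in fastforce)
  ultimately have "filterlim norm (at_left 1) (radially_to \<zeta>)"
    by (auto simp: filterlim_at elim!: eventually_mono)
  with f have "((\<lambda>q. f (of_real (norm q) * \<zeta>)) \<longlongrightarrow> L) (radially_to \<zeta>)"
    by (rule filterlim_compose)
  moreover have "\<forall>\<^sub>F q in radially_to \<zeta>. f (of_real (norm q) * \<zeta>) = f q"
    using ev seg by (auto elim!: eventually_mono)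
  ultimately show ?thesis by (rule Lim_transform_eventually)
qed

theorem theorem6p3:
  fixes r t m :: nat and \<zeta> :: complex
  assumes "r < t"
    and "0 < m"
    and "coprime m t"
    and "primitive_root_of_unity m \<zeta>"
  shows "(F_series (residue_set r t) \<longlongrightarrow> 1 / of_nat t) (radially_to \<zeta>)"
proof (rule tendsto_radially_to)
  define \<omega> where "\<omega> = cis (2 * pi / real t)"
  have t: "0 < t" using assms(1) by simp
  show n\<zeta>: "norm \<zeta> = 1" using assms(4) by (rule primitive_root_norm)
  have disk: "\<forall>\<^sub>F s in at_left 1. norm (of_real s * \<zeta>) < 1"
    by (rule eventually_at_leftI[of 0]) (auto simp: norm_mult n\<zeta>)
  have lim0: "((\<lambda>s. qratio 0 (of_real s * \<zeta>)) \<longlongrightarrow> 0) (at_left 1)"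
    using assms(2) by (intro qratio_radial_limit[OF assms(4)]) (auto simp: power_0_left)
  have lim: "((\<lambda>s. qratio (\<omega> ^ j) (of_real s * \<zeta>)) \<longlongrightarrow> (if j = 0 then 1 else 0)) (at_left 1)"
    if "j < t" for j
  proof (cases "j = 0")
    case True
    have "\<forall>\<^sub>F s in at_left 1. qratio 1 (of_real s * \<zeta>) = 1"
      using disk by eventually_elim (rule qratio_1)
    then show ?thesis using True by (auto intro: tendsto_eventually)
  next
    case False
    \<comment> \<open>By coprimality \<open>t dvd j * m\<close> would give \<open>t dvd j\<close>,
      impossible for \<open>0 < j < t\<close>.\<close>
    have "\<not> t dvd j * m"
      using False that assms(3) by (auto simp: coprime_commute coprime_dvd_mult_left_iff dest: dvd_imp_le)
    then have "(\<omega> ^ j) ^ m \<noteq> 1"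
      using cis_root_power_eq_1_iff[OF t] by (simp add: \<omega>_def flip: power_mult)
    then show ?thesis
      using qratio_radial_limit[OF assms(4), of "\<omega> ^ j"] False by (simp add: \<omega>_def norm_power)
  qed
  \<comment> \<open>Only \<open>j = 0\<close> survives, with coefficient 1; the correction for
    \<open>n = 0\<close> tends to 0 as well.\<close>
  have "((\<lambda>s. (\<Sum>j<t. qratio (\<omega> ^ j) (of_real s * \<zeta>) / (\<omega> ^ j) ^ r) / of_nat t
        - (if [0 = r] (mod t) then qratio 0 (of_real s * \<zeta>) else 0))
      \<longlongrightarrow> (\<Sum>j<t. (if j = 0 then 1 else 0) / (\<omega> ^ j) ^ r) / of_nat t
        - 0) (at_left 1)"
  proof (intro tendsto_diff tendsto_divide tendsto_sum tendsto_const)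
    show "((\<lambda>s. if [0 = r] (mod t) then qratio 0 (of_real s * \<zeta>) else 0)
        \<longlongrightarrow> 0) (at_left 1)"
      by (cases "[0 = r] (mod t)") (simp_all add: lim0)
  qed (use t lim in \<open>simp_all add: \<omega>_def\<close>)
  also have "(\<Sum>j<t. (if j = 0 then 1 else 0) / (\<omega> ^ j) ^ r) = (\<Sum>j<t. if j = 0 then 1 else 0)"
    by (intro sum.cong) auto
  also have "\<dots> = 1" using t by simp
  finally have "((\<lambda>s. (\<Sum>j<t. qratio (\<omega> ^ j) (of_real s * \<zeta>) / (\<omega> ^ j) ^ r) / of_nat t
        - (if [0 = r] (mod t) then qratio 0 (of_real s * \<zeta>) else 0)) \<longlongrightarrow> 1 / of_nat t) (at_left 1)"
    by simp
  then show "((\<lambda>s. F_series (residue_set r t) (of_real s * \<zeta>)) \<longlongrightarrow> 1 / of_nat t) (at_left 1)"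
  proof (rule Lim_transform_eventually)
    show "\<forall>\<^sub>F s in at_left 1.
        (\<Sum>j<t. qratio (\<omega> ^ j) (of_real s * \<zeta>) / (\<omega> ^ j) ^ r) / of_nat t
          - (if [0 = r] (mod t) then qratio 0 (of_real s * \<zeta>) else 0)
        = F_series (residue_set r t) (of_real s * \<zeta>)"
      using disk by eventually_elim (simp add: F_series_residue_set[OF t] \<omega>_def)
  qed
qed

end
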